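(* Let $(U,\mathscr{C})$ be a covering approximation space, where $U=\{x_1,\dots,x_n\}$ and $\mathscr{C}=\{C_1,\dots,C_m\}$, let $X\subseteq U$, and let $\mathcal{X}_X$ be the characteristic function of $X$ (as a column vector). Then $$\mathcal{X}_{XH_{\mathscr{C}}(X)}=\left(\prod(\mathscr{C})\right)^{T}\bullet\prod(\mathscr{C})\bullet\mathcal{X}_X,\qquad \mathcal{X}_{XL_{\mathscr{C}}(X)}=\prod(\mathscr{C})\odot\mathcal{X}_X.$$
   Context: A covering approximation space $(U,\mathscr{C})$ consists of a finite nonempty set $U=\{x_1,\dots,x_n\}$ (distinct elements) and a covering $\mathscr{C}=\{C_1,\dots,C_m\}$ of $U$, i.e. a family of nonempty subsets of $U$ with union $U$. For $x\in U$ put $N(x)=\bigcap\{C_i\mid x\in C_i\in\mathscr{C}\}$. For $X\subseteq U$, the sixth upper and lower approximations of $X$ are $XH_{\mathscr{C}}(X)=\bigcup\{N(x)\mid x\in U,\ N(x)\cap X\neq\emptyset\}$ and $XL_{\mathscr{C}}(X)=\bigcup\{N(x)\mid x\in U,\ N(x)\subseteq X\}$. The characteristic function of $X\subseteq U$ is the column vector $\mathcal{X}_X=[a_1\ \cdots\ a_n]^T$ with $a_i=1$ if $x_i\in X$ and $a_i=0$ otherwise. Matrix operations: for $0/1$ matrices $A=(a_{ik})_{n\times p}$ and $B=(b_{kj})_{p\times q}$, the Boolean product is $A\bullet B=(\bigvee_{k=1}^{p}(a_{ik}\cdot b_{kj}))_{n\times q}$, and $A\odot B=(\bigwedge_{k=1}^{p}(b_{kj}-a_{ik}+1))_{n\times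 q}$, where $\bigvee$ is maximum, $\bigwedge$ is minimum, and $+,-$ are ordinary integer operations. Unparenthesized products are evaluated from left to right. Let $M_{\mathscr{C}}=(a_{ij})_{n\times m}$ with $a_{ij}=1$ if $x_i\in C_j$ and $a_{ij}=0$ otherwise. The type-2 characteristic matrix of $\mathscr{C}$ is $\prod(\mathscr{C})=M_{\mathscr{C}}\odot M_{\mathscr{C}}^{T}=(c_{ij})_{n\times n}$, i.e. $c_{ij}=\bigwedge_{k=1}^{m}(a_{jk}-a_{ik}+1)$. *)

theory Defs
  imports Jordan_Normal_Form.Matrix
begin

definition covering_approx_space :: "'a set \<Rightarrow> 'a set set \<Rightarrow> bool" where
  "covering_approx_space U \<C> \<longleftrightarrow> finite U \<and> U \<noteq> {} \<and> {} \<notin> \<C> \<and> \<Union>\<C> = U"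

definition nbhd :: "'a set set \<Rightarrow> 'a \<Rightarrow> 'a set" where
  "nbhd \<C> x = \<Inter>{K. x \<in> K \<and> K \<in> \<C>}"

definition XH :: "'a set \<Rightarrow> 'a set set \<Rightarrow> 'a set \<Rightarrow> 'a set" where
  "XH U \<C> X = \<Union>{nbhd \<C> x | x. x \<in> U \<and> nbhd \<C> x \<inter> X \<noteq> {}}"

definition XL :: "'a set \<Rightarrow> 'a set set \<Rightarrow> 'a set \<Rightarrow> 'a set" where
  "XL U \<C> X = \<Union>{nbhd \<C> x | x. x \<in> U \<and> nbhd \<C> x \<subseteq> X}"

(* Matrices have integer entries, since the second product below uses integer
   subtraction; a column vector is a matrix with one column. Both products are only
   meaningful if the inner dimension dim_col A = dim_row B is positive, because Max and
   Min of the empty set are unspecified. *)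

definition bool_prod :: "int mat \<Rightarrow> int mat \<Rightarrow> int mat" (infixl "\<bullet>\<^sub>B" 70) where
  "A \<bullet>\<^sub>B B = mat (dim_row A) (dim_col B)
     (\<lambda>(i, j). Max ((\<lambda>k. A $$ (i, k) * B $$ (k, j)) ` {..<dim_col A}))"

definition odot_prod :: "int mat \<Rightarrow> int mat \<Rightarrow> int mat" (infixl "\<odot>\<^sub>B" 70) where
  "A \<odot>\<^sub>B B = mat (dim_row A) (dim_col B)
     (\<lambda>(i, j). Min ((\<lambda>k. B $$ (k, j) - A $$ (i, k) + 1) ` {..<dim_col A}))"

(* The lists xs and Cs are the enumerations x_1, ..., x_n of U and C_1, ..., C_m of the
   covering, so indices start at 0 here. *)

definition char_fun :: "'a list \<Rightarrow> 'a set \<Rightarrow> int mat" where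
  "char_fun xs X = mat (length xs) 1 (\<lambda>(i, j). if xs ! i \<in> X then 1 else 0)"

definition cov_mat :: "'a list \<Rightarrow> 'a set list \<Rightarrow> int mat" where
  "cov_mat xs Cs = mat (length xs) (length Cs) (\<lambda>(i, j). if xs ! i \<in> Cs ! j then 1 else 0)"

definition type2_char_mat :: "'a list \<Rightarrow> 'a set list \<Rightarrow> int mat" where
  "type2_char_mat xs Cs = cov_mat xs Cs \<odot>\<^sub>B transpose_mat (cov_mat xs Cs)"

end

theory Submission imports Defs begin

text \<open>
  Read a 0/1 matrix as a relation between indices. The Boolean product is then relational
  composition, and the second product is the residual \<open>\<forall>k. A i k \<longrightarrow> B k j\<close>, provided that no row
  of \<open>A\<close> is zero: a zero row can produce the entry 2. A covering has no zero row in its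
  incidence matrix, so its type-2 characteristic matrix is the relation \<open>x\<^sub>j \<in> N(x\<^sub>i)\<close>, which is
  reflexive and transitive. Transitivity reduces \<open>y \<in> XL(X)\<close> to \<open>N(y) \<subseteq> X\<close>.
\<close>

definition rel_mat :: "nat \<Rightarrow> nat \<Rightarrow> (nat \<Rightarrow> nat \<Rightarrow> bool) \<Rightarrow> int mat" where
  "rel_mat n m R = mat n m (\<lambda>(i, j). of_bool (R i j))"

lemma rel_mat_cong:
  assumes "\<And>i j. i < n \<Longrightarrow> j < m \<Longrightarrow> R i j = S i j"
  shows "rel_mat n m R = rel_mat n m S"
  using assms by (auto simp: rel_mat_def)

lemma transpose_rel_mat: "transpose_mat (rel_mat n m R) = rel_mat m n (\<lambda>i j. R j i)"
  by (auto simp: rel_mat_def)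

text \<open>\<open>K \<noteq> {}\<close> is needed because \<open>Max\<close> of the empty set is
  unspecified.\<close>

lemma Max_of_bool:
  assumes "finite K" and "K \<noteq> {}"
  shows "Max ((\<lambda>k. of_bool (P k) :: int) ` K) = of_bool (\<exists>k\<in>K. P k)"
  using assms by (intro Max_eqI) (auto simp: image_iff)

text \<open>The term at \<open>k\<close> is 0 exactly when \<open>P k\<close> holds and
  \<open>Q k\<close> fails, and it is 2 when only \<open>Q k\<close> holds. An index satisfying
  \<open>P\<close> contributes at most 1, so the minimum cannot be 2.\<close>

lemma Min_of_bool_diff:
  assumes "finite K" and "\<exists>k\<in>K. P k"
  shows "Min ((\<lambda>k. of_bool (Q k) - of_bool (P k) + 1 :: int) ` K)
    = of_bool (\<forall>k\<in>K. P k \<longrightarrow> Q k)"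
proof (rule Min_eqI)
  show "of_bool (\<forall>k\<in>K. P k \<longrightarrow> Q k) \<in> (\<lambda>k. of_bool (Q k) - of_bool (P k) + 1 :: int) ` K"
  proof (cases "\<forall>k\<in>K. P k \<longrightarrow> Q k")
    case True
    \<comment> \<open>Any \<open>k\<close> with \<open>P k\<close> also satisfies \<open>Q k\<close>
      here, so its term is the required 1.\<close>
    with assms(2) show ?thesis by (force simp: image_iff)
  next
    case False
    then obtain k where "k \<in> K" "P k" "\<not> Q k" by blast
    then show ?thesis by (auto simp: image_iff intro!: bexI[of _ k])
  qed
qed (use assms(1) in auto)

lemma bool_prod_rel_mat:
  assumes "0 < p"
  shows "rel_mat n p R \<bullet>\<^sub>B rel_mat p q S = rel_mat n q (\<lambda>i j. \<exists>k<p. R i k \<and> S k j)"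
proof (rule eq_matI)
  fix i j
  assume "i < dim_row (rel_mat n q (\<lambda>i j. \<exists>k<p. R i k \<and> S k j))"
    and "j < dim_col (rel_mat n q (\<lambda>i j. \<exists>k<p. R i k \<and> S k j))"
  then have ij: "i < n" "j < q" by (simp_all add: rel_mat_def)
  have "(rel_mat n p R \<bullet>\<^sub>B rel_mat p q S) $$ (i, j)
      = Max ((\<lambda>k. of_bool (R i k \<and> S k j)) ` {..<p})"
    using ij by (auto simp: bool_prod_def rel_mat_def of_bool_conj intro!: arg_cong[of _ _ Max])
  then show "(rel_mat n p R \<bullet>\<^sub>B rel_mat p q S) $$ (i, j)
      = rel_mat n q (\<lambda>i j. \<exists>k<p. R i k \<and> S k j) $$ (i, j)"
    using ij assms by (subst (asm) Max_of_bool) (auto simp: rel_mat_def lessThan_empty_iff)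
qed (simp_all add: bool_prod_def rel_mat_def)

text \<open>The row condition supplies the index that \<open>Min_of_bool_diff\<close> asks for; it
  also forces \<open>0 < p\<close> as soon as there is a row.\<close>

lemma odot_prod_rel_mat:
  assumes "\<And>i. i < n \<Longrightarrow> \<exists>k<p. R i k"
  shows "rel_mat n p R \<odot>\<^sub>B rel_mat p q S = rel_mat n q (\<lambda>i j. \<forall>k<p. R i k \<longrightarrow> S k j)"
proof (rule eq_matI)
  fix i j
  assume "i < dim_row (rel_mat n q (\<lambda>i j. \<forall>k<p. R i k \<longrightarrow> S k j))"
    and "j < dim_col (rel_mat n q (\<lambda>i j. \<forall>k<p. R i k \<longrightarrow> S k j))"
  then have ij: "i < n" "j < q" by (simp_all add: rel_mat_def)
  have "(rel_mat n p R \<odot>\<^sub>B rel_mat p q S) $$ (i, j)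
      = Min ((\<lambda>k. of_bool (S k j) - of_bool (R i k) + 1) ` {..<p})"
    using ij by (auto simp: odot_prod_def rel_mat_def intro!: arg_cong[of _ _ Min])
  then show "(rel_mat n p R \<odot>\<^sub>B rel_mat p q S) $$ (i, j)
      = rel_mat n q (\<lambda>i j. \<forall>k<p. R i k \<longrightarrow> S k j) $$ (i, j)"
    using ij assms[of i] by (subst (asm) Min_of_bool_diff) (auto simp: rel_mat_def)
qed (simp_all add: odot_prod_def rel_mat_def)

lemma char_fun_eq_rel_mat: "char_fun xs X = rel_mat (length xs) 1 (\<lambda>i j. xs ! i \<in> X)"
  by (auto simp: char_fun_def rel_mat_def)

lemma cov_mat_eq_rel_mat:
  "cov_mat xs Cs = rel_mat (length xs) (length Cs) (\<lambda>i j. xs ! i \<in> Cs ! j)"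
  by (auto simp: cov_mat_def rel_mat_def)

text \<open>The residual of the incidence relation with its converse says that every block
  containing \<open>xs ! i\<close> contains \<open>xs ! j\<close>, which is membership in the
  intersection of those blocks.\<close>

lemma type2_char_mat_eq_rel_mat:
  assumes "set xs \<subseteq> \<Union>(set Cs)"
  shows "type2_char_mat xs Cs
    = rel_mat (length xs) (length xs) (\<lambda>i j. xs ! j \<in> nbhd (set Cs) (xs ! i))"
proof -
  have "\<exists>k<length Cs. xs ! i \<in> Cs ! k" if "i < length xs" for i
    using that assms by (metis UnionE in_set_conv_nth nth_mem subsetD)
  then have "type2_char_mat xs Cs = rel_mat (length xs) (length xs)
      (\<lambda>i j. \<forall>k<length Cs. xs ! i \<in> Cs ! k \<longrightarrow> xs ! j \<in> Cs ! k)"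
    by (simp add: type2_char_mat_def cov_mat_eq_rel_mat transpose_rel_mat odot_prod_rel_mat)
  also have "\<dots> = rel_mat (length xs) (length xs) (\<lambda>i j. xs ! j \<in> nbhd (set Cs) (xs ! i))"
    by (rule rel_mat_cong) (auto simp: nbhd_def in_set_conv_nth)
  finally show ?thesis .
qed

lemma mem_nbhd_self: "x \<in> nbhd \<C> x"
  by (simp add: nbhd_def)

text \<open>Every block containing \<open>x\<close> contains \<open>y\<close>, so the intersection
  for \<open>y\<close> runs over at least as many blocks. This is the transitivity.\<close>

lemma nbhd_mono: "y \<in> nbhd \<C> x \<Longrightarrow> nbhd \<C> y \<subseteq> nbhd \<C> x"
  by (auto simp: nbhd_def)

text \<open>A point outside all blocks would have the empty intersection \<open>UNIV\<close> as
  neighbourhood.\<close>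

lemma nbhd_subset_Union: "x \<in> \<Union>\<C> \<Longrightarrow> nbhd \<C> x \<subseteq> \<Union>\<C>"
  by (auto simp: nbhd_def)

text \<open>If \<open>y\<close> lies in some neighbourhood inside \<open>X\<close>, monotonicity
  puts \<open>nbhd \<C> y\<close> inside \<open>X\<close> too; conversely \<open>y\<close> is its
  own witness.\<close>

lemma mem_XL_iff: "y \<in> U \<Longrightarrow> y \<in> XL U \<C> X \<longleftrightarrow> nbhd \<C> y \<subseteq> X"
  using nbhd_mono mem_nbhd_self by (fastforce simp: XL_def)

lemma mem_XH_iff: "y \<in> XH U \<C> X \<longleftrightarrow> (\<exists>x\<in>U. y \<in> nbhd \<C> x \<and> nbhd \<C> x \<inter> X \<noteq> {})"
  by (auto simp: XH_def)

theorem theorem3p5: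
  fixes U :: "'a set" and \<C> :: "'a set set" and xs :: "'a list" and Cs :: "'a set list"
    and X :: "'a set"
  assumes "covering_approx_space U \<C>"
    and "distinct xs" and "set xs = U"
    and "set Cs = \<C>"
    and "X \<subseteq> U"
  shows "char_fun xs (XH U \<C> X)
           = transpose_mat (type2_char_mat xs Cs) \<bullet>\<^sub>B type2_char_mat xs Cs \<bullet>\<^sub>B char_fun xs X
       \<and> char_fun xs (XL U \<C> X) = type2_char_mat xs Cs \<odot>\<^sub>B char_fun xs X"
proof
  let ?n = "length xs"
  have cover: "\<Union>\<C> = U" and "U \<noteq> {}"
    using assms(1) by (auto simp: covering_approx_space_def)
  then have pos: "0 < ?n" using assms(3) by auto
  have T: "type2_char_mat xs Cs = rel_mat ?n ?n (\<lambda>i j. xs ! j \<in> nbhd \<C> (xs ! i))"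
    using type2_char_mat_eq_rel_mat[of xs Cs] assms(3,4) cover by simp
  have U_nth: "U = (!) xs ` {..<?n}"
    using assms(3) by (auto simp: in_set_conv_nth image_iff)
  \<comment> \<open>The nesting mirrors the left-to-right product: \<open>k\<close> is the inner
    index of the first product, whose left factor is transposed, and \<open>l\<close> that of the
    second.\<close>
  have "xs ! i \<in> XH U \<C> X \<longleftrightarrow> (\<exists>l<?n. (\<exists>k<?n. xs ! i \<in> nbhd \<C> (xs ! k) \<and>
      xs ! l \<in> nbhd \<C> (xs ! k)) \<and> xs ! l \<in> X)" for i
  proof -
    have "xs ! i \<in> XH U \<C> X \<longleftrightarrow>
        (\<exists>z\<in>U. (\<exists>x\<in>U. xs ! i \<in> nbhd \<C> x \<and> z \<in> nbhd \<C> x) \<and> z \<in> X)"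
      using assms(5) unfolding mem_XH_iff by blast
    then show ?thesis unfolding U_nth by auto
  qed
  then show "char_fun xs (XH U \<C> X)
      = transpose_mat (type2_char_mat xs Cs) \<bullet>\<^sub>B type2_char_mat xs Cs \<bullet>\<^sub>B char_fun xs X"
    by (simp add: T char_fun_eq_rel_mat transpose_rel_mat bool_prod_rel_mat[OF pos])
  have "xs ! i \<in> XL U \<C> X \<longleftrightarrow> (\<forall>k<?n. xs ! k \<in> nbhd \<C> (xs ! i) \<longrightarrow> xs ! k \<in> X)"
    if "i < ?n" for i
  proof -
    have "xs ! i \<in> U" using that U_nth by blast
    \<comment> \<open>Indices only reach points of \<open>U\<close>, so inclusion in
      \<open>X\<close> can be tested on indices only if the neighbourhood stays in
      \<open>U\<close>.\<close>
    then have "nbhd \<C> (xs ! i) \<subseteq> U"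
      using nbhd_subset_Union[of "xs ! i" \<C>] cover by simp
    then have "nbhd \<C> (xs ! i) \<subseteq> X \<longleftrightarrow> (\<forall>y\<in>U. y \<in> nbhd \<C> (xs ! i) \<longrightarrow> y \<in> X)"
      by blast
    then have "xs ! i \<in> XL U \<C> X \<longleftrightarrow> (\<forall>y\<in>U. y \<in> nbhd \<C> (xs ! i) \<longrightarrow> y \<in> X)"
      using mem_XL_iff[OF \<open>xs ! i \<in> U\<close>, of \<C> X] by (rule trans[rotated])
    then show ?thesis unfolding U_nth by auto
  qed
  \<comment> \<open>Reflexivity, with \<open>k = i\<close>, rules out zero rows for the second use
    of the residual.\<close>
  moreover have "\<exists>k<?n. xs ! k \<in> nbhd \<C> (xs ! i)" if "i < ?n" for i
    using that mem_nbhd_self by metis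
  ultimately show "char_fun xs (XL U \<C> X) = type2_char_mat xs Cs \<odot>\<^sub>B char_fun xs X"
    by (simp add: T char_fun_eq_rel_mat odot_prod_rel_mat cong: rel_mat_cong)
qed

end
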